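(* Let $V\tilde g$ be a linear ordinary differential equation Gaussian process (LODE-GP) for the controllable system $\partial_t x = Ax + Bu$ with $A \in \mathbb{R}^{n_x\times n_x}$, $B \in \mathbb{R}^{n_x \times n_u}$, conditioned on a finite dataset with Gaussian noise, and let $t^* = (t^*_1,\dots,t^*_{n_*})$ be a grid of time points. Let $z_{\min}, z_{\max} \in \mathbb{R}^{n_z}$, $n_z = n_x + n_u$, with $z_{\min} < z_{\max}$ componentwise, and let $\mathcal{TGP}(\cdot \mid t^* )$ be the truncation of the distribution of $V\tilde g(t^* )$ to the constraints $[z_{\min}, z_{\max}]$. Then the support of $\mathcal{TGP}(\cdot \mid t^* )$ fulfills the ODE structure and the constraints; that is, every $(z_1,\dots,z_{n_*}) \in (\mathbb{R}^{n_z})^{n_*}$ in the support satisfies: (i) there is a solution $(x,u)$ of $\partial_t x = Ax + Bu$ with $(x(t^*_j),u(t^*_j)) = z_j$ for all $j = 1,\dots,n_*$; and (ii) $z_{\min} \le z_j \le z_{\max}$ componentwise for all $j$, i.e. the state and input bounds $x_{\min} \le x(t_j^* ) \le x_{\max}$ and $u_{\min} \le u(t_j^* ) \le u_{\max}$ hold.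
   Context: Notation: state and input are stacked as $z = (x,u) \in \mathbb{R}^{n_z}$, and $z_{\min} = (x_{\min},u_{\min})$, $z_{\max} = (x_{\max},u_{\max})$. LODE-GP: write the system as $Hz = 0$ with $H = (A - \partial_t I \mid B) \in \mathbb{R}[\partial_t]^{n_x \times n_z}$, and take a Smith normal form factorization $QHV = D$ with $Q \in \mathbb{R}[\partial_t]^{n_x\times n_x}$, $V \in \mathbb{R}[\partial_t]^{n_z \times n_z}$ invertible over $\mathbb{R}[\partial_t]$ and $D$ diagonal. By controllability the diagonal entries of $D$ are $0$ or $1$ (columns beyond the number of rows count as zero). The latent Gaussian process is $\tilde g = \mathcal{GP}(0,\tilde K)$ with diagonal matrix $\tilde K$ of kernels: the zero kernel in positions where $D$ has entry $1$, and a scalar covariance function (squared exponential, or Matérn of sufficient smoothness) in positions where $D$ has entry $0$. The latent kernels are assumed smooth enough that the differential operator $V$ can be applied to the realizations of $\tilde g$. The LODE-GP is $V\tilde g = \mathcal{GP}(0, V \tilde K \hat V^\top)$, where $\hat V$ is $V$ acting on the second kernel argument; its realizations satisfy $Hz=0$ (almost surely). It may be conditioned on finitely many observations with independent Gaussian noise of positive (possibly observation-dependent) variance in the usual Gaussian process regression sense, and $V\tilde g(t^* )$ denotes the resulting (possibly degenerate) Gaussian random vector in $(\mathbb{R}^{n_z})^{n_*}$ of values at the grid points. Truncation: let $\mathcal{U}(z,z_{\min},z_{\max})$ be the uniform likelihood, a positive constant if $z$ lies in the box $[z_{\min},z_{\max}]$ and $0$ otherwise, imposed at every grid point. By Bayes'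 rule, $$\mathcal{TGP}(z \mid t^* ) = \frac{V\tilde g(t^* ) \cdot \mathcal{U}(z,z_{\min},z_{\max})}{\int_{z_{\min}}^{z_{\max}} V\tilde g(t^* \mid f)\,\mathrm{d}f},$$ i.e. if $\gamma$ is the law of $V\tilde g(t^* )$ and $C = \{(z_1,\dots,z_{n_*}) : z_{\min} \le z_j \le z_{\max} \ \forall j\}$, then $\mathcal{TGP}(E \mid t^* ) = \gamma(E \cap C)/\gamma(C)$ for Borel sets $E$, where it is assumed that $\gamma(C) > 0$ so that this is defined. The support of a distribution is the smallest closed set of full measure. *)

theory Defs
  imports "HOL-Probability.Probability" "HOL-Computational_Algebra.Polynomial"
begin

section \<open>Linear control systems\<close>

definition stack :: "real ^ 'nx \<Rightarrow> real ^ 'nu \<Rightarrow> real ^ ('nx + 'nu)" where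
  "stack x u = (\<chi> c. case c of Inl i \<Rightarrow> x $ i | Inr j \<Rightarrow> u $ j)"

text \<open>Only continuous inputs are required, since the latent kernels may have finite smoothness.\<close>

definition ode_solution ::
  "real ^ 'nx ^ 'nx \<Rightarrow> real ^ 'nu ^ 'nx \<Rightarrow> (real \<Rightarrow> real ^ 'nx) \<Rightarrow> (real \<Rightarrow> real ^ 'nu) \<Rightarrow> bool"
where
  "ode_solution A B x u \<longleftrightarrow>
     continuous_on UNIV u \<and>
     (\<forall>t. (x has_vector_derivative (A *v x t + B *v u t)) (at t))"

definition controllable :: "real ^ 'nx ^ 'nx \<Rightarrow> real ^ 'nu ^ 'nx \<Rightarrow> bool" where
  "controllable A B \<longleftrightarrow>
     (\<forall>x0 x1. \<exists>T>0. \<exists>x u. ode_solution A B x u \<and> x 0 = x0 \<and> x T = x1)"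


section \<open>Polynomial matrices in the differentiation operator\<close>

text \<open>The polynomial ring in the operator \<open>d/dt\<close> is \<^typ>\<open>real poly\<close>, with
  \<open>d/dt\<close> represented by \<open>[:0, 1:]\<close>; the matrix below is \<open>(A - d/dt I | B)\<close>.\<close>

definition system_matrix ::
  "real ^ 'nx ^ 'nx \<Rightarrow> real ^ 'nu ^ 'nx \<Rightarrow> real poly ^ ('nx + 'nu) ^ 'nx"
where
  "system_matrix A B =
     (\<chi> i c. case c of
        Inl k \<Rightarrow> [:A $ i $ k:] - (if i = k then [:0, 1:] else 0)
      | Inr l \<Rightarrow> [:B $ i $ l:])"

text \<open>The \<open>i\<close>-th diagonal position of an \<open>n\<^sub>x \<times> (n\<^sub>x + n\<^sub>u)\<close> matrix is \<open>(i, Inl i)\<close>; the columns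
  \<open>Inr l\<close> lie beyond the rows and have diagonal entry zero.\<close>

definition diag_entry ::
  "real poly ^ ('nx :: finite + 'nu :: finite) ^ 'nx \<Rightarrow> 'nx + 'nu \<Rightarrow> real poly"
where
  "diag_entry D c = (case c of Inl i \<Rightarrow> D $ i $ Inl i | Inr l \<Rightarrow> 0)"

text \<open>The index type carries no order, so the divisibility chain of the invariant factors is
  expressed by comparability. Invariant factors are normalized to be monic or zero.\<close>

definition smith_form :: "real poly ^ ('nx :: finite + 'nu :: finite) ^ 'nx \<Rightarrow> bool" where
  "smith_form D \<longleftrightarrow>
     (\<forall>i c. c \<noteq> Inl i \<longrightarrow> D $ i $ c = 0) \<and>
     (\<forall>i. D $ i $ Inl i = 0 \<or> lead_coeff (D $ i $ Inl i) = 1) \<and>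
     (\<forall>i k. D $ i $ Inl i dvd D $ k $ Inl k \<or> D $ k $ Inl k dvd D $ i $ Inl i)"

definition smith_factorization ::
  "real poly ^ ('nx :: finite + 'nu :: finite) ^ 'nx \<Rightarrow> real poly ^ 'nx ^ 'nx \<Rightarrow>
   real poly ^ ('nx + 'nu) ^ ('nx + 'nu) \<Rightarrow> real poly ^ ('nx + 'nu) ^ 'nx \<Rightarrow> bool"
where
  "smith_factorization H Q V D \<longleftrightarrow>
     invertible Q \<and> invertible V \<and> Q ** H ** V = D \<and> smith_form D"

definition diff_op :: "real poly \<Rightarrow> (real \<Rightarrow> real) \<Rightarrow> real \<Rightarrow> real" where
  "diff_op p f t = (\<Sum>i\<le>degree p. coeff p i * (deriv ^^ i) f t)"


section \<open>Covariance functions and the LODE-GP kernel\<close>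

definition covariance_function :: "(real \<Rightarrow> real \<Rightarrow> real) \<Rightarrow> bool" where
  "covariance_function k \<longleftrightarrow>
     (\<forall>s t. k s t = k t s) \<and>
     (\<forall>T a. finite T \<longrightarrow> (\<Sum>s\<in>T. \<Sum>t\<in>T. a s * a t * k s t) \<ge> 0)"

text \<open>\<open>kernel_partial k p q\<close> differentiates \<open>q\<close> times in the second argument, then \<open>p\<close> times in
  the first.\<close>

definition kernel_partial ::
  "(real \<Rightarrow> real \<Rightarrow> real) \<Rightarrow> nat \<Rightarrow> nat \<Rightarrow> real \<Rightarrow> real \<Rightarrow> real"
where
  "kernel_partial k p q s t = (deriv ^^ p) (\<lambda>s'. (deriv ^^ q) (k s') t) s"

text \<open>All mixed partial derivatives of order at most \<open>d\<close> in each argument exist and are jointly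
  continuous. This necessarily holds for the covariance function of a centred Gaussian process
  with \<open>d\<close> times continuously differentiable realizations. Because \<^const>\<open>deriv\<close> is total,
  differentiability is demanded explicitly.\<close>

definition smooth_kernel :: "nat \<Rightarrow> (real \<Rightarrow> real \<Rightarrow> real) \<Rightarrow> bool" where
  "smooth_kernel d k \<longleftrightarrow>
     (\<forall>q<d. \<forall>s t. (deriv ^^ q) (k s) differentiable (at t)) \<and>
     (\<forall>p<d. \<forall>q\<le>d. \<forall>s t. (\<lambda>s'. kernel_partial k p q s' t) differentiable (at s)) \<and>
     (\<forall>p\<le>d. \<forall>q\<le>d. continuous_on UNIV (\<lambda>(s, t). kernel_partial k p q s t))"

text \<open>The order of the differential operator that \<open>V\<close> applies to latent component \<open>c\<close>.\<close>

definition column_order :: "real poly ^ 'c ^ 'c \<Rightarrow> 'c \<Rightarrow> nat" where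
  "column_order V c = Max (range (\<lambda>a. degree (V $ a $ c)))"

definition latent_kernel ::
  "real poly ^ ('nx :: finite + 'nu :: finite) ^ 'nx \<Rightarrow> ('nx + 'nu \<Rightarrow> real \<Rightarrow> real \<Rightarrow> real) \<Rightarrow>
   'nx + 'nu \<Rightarrow> real \<Rightarrow> real \<Rightarrow> real"
where
  "latent_kernel D \<kappa> c = (if diag_entry D c = 1 then (\<lambda>s t. 0) else \<kappa> c)"

text \<open>A matrix-valued kernel is a function \<open>K s a t b\<close>: the covariance of component \<open>a\<close> at time
  \<open>s\<close> with component \<open>b\<close> at time \<open>t\<close>. For a diagonal latent kernel \<open>k\<close>, the \<open>(a, b)\<close> entry of
  \<open>V k V\<^sup>T\<close>, with the left \<open>V\<close> acting on the first and the right one on the second argument.\<close>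

definition pushforward_kernel ::
  "real poly ^ 'c ^ 'c \<Rightarrow> ('c \<Rightarrow> real \<Rightarrow> real \<Rightarrow> real) \<Rightarrow>
   real \<Rightarrow> 'c \<Rightarrow> real \<Rightarrow> 'c \<Rightarrow> real"
where
  "pushforward_kernel V k s a t b =
     (\<Sum>c\<in>UNIV. diff_op (V $ a $ c) (\<lambda>s'. diff_op (V $ b $ c) (k c s') t) s)"

definition lode_kernel ::
  "real poly ^ ('nx :: finite + 'nu :: finite) ^ ('nx + 'nu) \<Rightarrow> real poly ^ ('nx + 'nu) ^ 'nx \<Rightarrow>
   ('nx + 'nu \<Rightarrow> real \<Rightarrow> real \<Rightarrow> real) \<Rightarrow>
   real \<Rightarrow> 'nx + 'nu \<Rightarrow> real \<Rightarrow> 'nx + 'nu \<Rightarrow> real"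
where
  "lode_kernel V D \<kappa> = pushforward_kernel V (latent_kernel D \<kappa>)"


section \<open>Gaussian process regression\<close>

text \<open>An observation is a noisy measurement of one component at one time; a measurement of a full
  vector consists of one observation for each component.\<close>

datatype 'c observation =
  Observation (obs_time: real) (obs_channel: 'c) (obs_value: real) (obs_var: real)

definition noisy_gram ::
  "(real \<Rightarrow> 'c \<Rightarrow> real \<Rightarrow> 'c \<Rightarrow> real) \<Rightarrow> 'c observation list \<Rightarrow> nat \<Rightarrow> nat \<Rightarrow> real"
where
  "noisy_gram K obs i l =
     K (obs_time (obs ! i)) (obs_channel (obs ! i)) (obs_time (obs ! l)) (obs_channel (obs ! l))
     + (if i = l then obs_var (obs ! i) else 0)"

text \<open>The inverse of an \<open>n \<times> n\<close> matrix \<open>G\<close> given by its entries. The dimension is a number rather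
  than a type so that the data set may be empty. Only entries below \<open>n\<close> are ever used, and for
  a positive semidefinite \<open>K\<close> and positive noise variances \<^term>\<open>noisy_gram K obs\<close> is positive
  definite, so the choice is determined there.\<close>

definition inverse_entries :: "nat \<Rightarrow> (nat \<Rightarrow> nat \<Rightarrow> real) \<Rightarrow> nat \<Rightarrow> nat \<Rightarrow> real" where
  "inverse_entries n G =
     (SOME W. \<forall>i<n. \<forall>l<n.
        (\<Sum>m<n. G i m * W m l) = (if i = l then 1 else 0) \<and>
        (\<Sum>m<n. W i m * G m l) = (if i = l then 1 else 0))"

definition posterior_mean ::
  "(real \<Rightarrow> 'c \<Rightarrow> real \<Rightarrow> 'c \<Rightarrow> real) \<Rightarrow> 'c observation list \<Rightarrow> real \<Rightarrow> 'c \<Rightarrow> real"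
where
  "posterior_mean K obs t a =
     (let n = length obs; W = inverse_entries n (noisy_gram K obs) in
      \<Sum>i<n. \<Sum>l<n.
        K t a (obs_time (obs ! i)) (obs_channel (obs ! i)) * W i l * obs_value (obs ! l))"

definition posterior_cov ::
  "(real \<Rightarrow> 'c \<Rightarrow> real \<Rightarrow> 'c \<Rightarrow> real) \<Rightarrow> 'c observation list \<Rightarrow>
   real \<Rightarrow> 'c \<Rightarrow> real \<Rightarrow> 'c \<Rightarrow> real"
where
  "posterior_cov K obs s a t b =
     (let n = length obs; W = inverse_entries n (noisy_gram K obs) in
      K s a t b -
      (\<Sum>i<n. \<Sum>l<n.
        K s a (obs_time (obs ! i)) (obs_channel (obs ! i)) * W i l *
        K (obs_time (obs ! l)) (obs_channel (obs ! l)) t b))"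


section \<open>Gaussian laws, truncation and support\<close>

definition normal_law :: "real \<Rightarrow> real \<Rightarrow> real measure" where
  "normal_law m v =
     (if v = 0 then return borel m else density lborel (normal_density m (sqrt v)))"

text \<open>A possibly degenerate Gaussian law on \<open>'g\<close>-tuples of vectors with mean \<open>m\<close> and covariance
  \<open>S j a k b\<close> of the entries \<open>(j, a)\<close> and \<open>(k, b)\<close>: every linear functional is normal.\<close>

definition gaussian_law ::
  "(real ^ 'c ^ 'g) measure \<Rightarrow> ('g \<Rightarrow> 'c \<Rightarrow> real) \<Rightarrow>
   ('g \<Rightarrow> 'c \<Rightarrow> 'g \<Rightarrow> 'c \<Rightarrow> real) \<Rightarrow> bool"
where
  "gaussian_law \<gamma> m S \<longleftrightarrow>
     prob_space \<gamma> \<and> sets \<gamma> = sets borel \<and>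
     (\<forall>w :: real ^ 'c ^ 'g.
        let \<mu> = (\<Sum>j\<in>UNIV. \<Sum>a\<in>UNIV. w $ j $ a * m j a);
            v = (\<Sum>j\<in>UNIV. \<Sum>a\<in>UNIV. \<Sum>k\<in>UNIV. \<Sum>b\<in>UNIV.
                   w $ j $ a * w $ k $ b * S j a k b)
        in 0 \<le> v \<and> distr \<gamma> borel (\<lambda>z. w \<bullet> z) = normal_law \<mu> v)"

text \<open>The law of the values at the grid \<open>\<tau>\<close> of the Gaussian process with mean zero and covariance
  \<open>K\<close>, conditioned on \<open>obs\<close>.\<close>

definition conditioned_gp_law ::
  "(real ^ 'c ^ 'g) measure \<Rightarrow> (real \<Rightarrow> 'c \<Rightarrow> real \<Rightarrow> 'c \<Rightarrow> real) \<Rightarrow>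
   'c observation list \<Rightarrow> ('g \<Rightarrow> real) \<Rightarrow> bool"
where
  "conditioned_gp_law \<gamma> K obs \<tau> \<longleftrightarrow>
     gaussian_law \<gamma> (\<lambda>j a. posterior_mean K obs (\<tau> j) a)
       (\<lambda>j a k b. posterior_cov K obs (\<tau> j) a (\<tau> k) b)"

definition grid_box :: "real ^ 'c \<Rightarrow> real ^ 'c \<Rightarrow> (real ^ 'c ^ 'g) set" where
  "grid_box zmin zmax = {z. \<forall>j a. zmin $ a \<le> z $ j $ a \<and> z $ j $ a \<le> zmax $ a}"

text \<open>By \<open>emeasure_uniform_measure\<close>, \<open>E\<close> has mass \<open>\<gamma> (E \<inter> C) / \<gamma> C\<close>, where \<open>C\<close> is the box.\<close>

definition truncated_law ::
  "(real ^ 'c ^ 'g) measure \<Rightarrow> real ^ 'c \<Rightarrow> real ^ 'c \<Rightarrow> (real ^ 'c ^ 'g) measure"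
where
  "truncated_law \<gamma> zmin zmax = uniform_measure \<gamma> (grid_box zmin zmax)"

text \<open>The smallest closed set of full measure; the lemma below shows that on a second countable
  space the intersection itself has full measure.\<close>

definition measure_support :: "'a :: topological_space measure \<Rightarrow> 'a set" where
  "measure_support \<mu> = \<Inter>{F. closed F \<and> emeasure \<mu> (space \<mu> - F) = 0}"

lemma closed_measure_support: "closed (measure_support \<mu>)"
  unfolding measure_support_def by auto

lemma measure_support_full:
  fixes \<mu> :: "'a :: second_countable_topology measure"
  assumes "sets \<mu> = sets borel"
  shows "emeasure \<mu> (space \<mu> - measure_support \<mu>) = 0"
proof -
  have sp: "space \<mu> = UNIV"
    using sets_eq_imp_space_eq[OF assms] by simp
  let ?U = "{U. open U \<and> emeasure \<mu> U = 0}"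
  obtain \<U> where \<U>: "\<U> \<subseteq> ?U" "countable \<U>" "\<Union>\<U> = \<Union>?U"
    using Lindelof[of ?U] by blast
  have "- measure_support \<mu> = \<Union>?U"
  proof (intro set_eqI iffI)
    fix x assume "x \<in> - measure_support \<mu>"
    then obtain F where "closed F" "emeasure \<mu> (UNIV - F) = 0" "x \<notin> F"
      unfolding measure_support_def sp by blast
    then show "x \<in> \<Union>?U"
      by (intro UnionI[of "UNIV - F"]) (auto simp: Compl_eq_Diff_UNIV[symmetric])
  next
    fix x assume "x \<in> \<Union>?U"
    then obtain U where "open U" "emeasure \<mu> U = 0" "x \<in> U"
      by blast
    then show "x \<in> - measure_support \<mu>"
      unfolding measure_support_def sp by (auto intro!: exI[of _ "- U"])
  qed
  moreover have "\<Union>\<U> \<in> null_sets \<mu>"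
  proof -
    have "U \<in> null_sets \<mu>" if "U \<in> \<U>" for U
      using \<U>(1) that assms by (intro null_setsI) auto
    then show ?thesis
      using null_sets_UN'[OF \<U>(2), of "\<lambda>U. U"] by simp
  qed
  ultimately show ?thesis
    using \<U>(3) sp by (simp add: Compl_eq_Diff_UNIV[symmetric] null_sets_def)
qed

end

theory Submission
  imports Defs "HOL-Computational_Algebra.Fundamental_Theorem_Algebra"
begin

text \<open>Every column \<open>s \<mapsto> K s \<cdot> t b\<close> of the LODE-GP kernel is a trajectory of the
  system: the columns of \<open>V\<close> that carry a nonzero latent kernel are annihilated by \<open>H\<close>. Hence the
  posterior mean and the columns of the posterior covariance, restricted to the grid, lie in the
  subspace \<open>L\<close> of grid values of trajectories. A functional orthogonal to \<open>L\<close> then has mean and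
  variance zero, so the Gaussian law is concentrated on \<open>L\<close>, which is closed because it is finite
  dimensional. That a diagonal entry of \<open>D\<close> is \<open>0\<close> or \<open>1\<close> follows from the Hautus argument: at a
  complex root of any other entry a row of \<open>Q\<close> evaluates to a left eigenvector of \<open>A\<close> that
  annihilates \<open>B\<close>, which controllability forbids.\<close>

section \<open>Diagonal entries of the Smith form\<close>

text \<open>Complex points are used because a nonconstant real polynomial may have no real root. The
  rules below make evaluation a ring homomorphism, so identities between polynomial matrices survive
  it.\<close>

definition complex_eval :: "complex \<Rightarrow> real poly \<Rightarrow> complex" where
  "complex_eval z p = poly (map_poly of_real p) z"

lemma complex_eval_pCons [simp]: "complex_eval z (pCons a p) = of_real a + z * complex_eval z p"
  by (simp add: complex_eval_def map_poly_pCons)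

lemma complex_eval_0 [simp]: "complex_eval z 0 = 0"
  by (simp add: complex_eval_def)

lemma complex_eval_1 [simp]: "complex_eval z 1 = 1"
  by (simp add: one_pCons)

lemma complex_eval_add: "complex_eval z (p + q) = complex_eval z p + complex_eval z q"
  by (induction p q rule: poly_induct2) (simp_all add: algebra_simps)

lemma complex_eval_smult: "complex_eval z (smult a p) = of_real a * complex_eval z p"
  by (induction p) (simp_all add: algebra_simps)

lemma complex_eval_mult: "complex_eval z (p * q) = complex_eval z p * complex_eval z q"
  by (induction p) (simp_all add: complex_eval_add complex_eval_smult algebra_simps)

lemma complex_eval_sum: "complex_eval z (sum f S) = (\<Sum>x\<in>S. complex_eval z (f x))"
  by (induction S rule: infinite_finite_induct) (simp_all add: complex_eval_add)

lemma complex_eval_root_exists: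
  assumes "degree p \<noteq> 0"
  obtains z where "complex_eval z p = 0"
proof -
  have "degree (map_poly complex_of_real p) = degree p"
    by (rule degree_map_poly) simp
  then have "\<not> constant (poly (map_poly complex_of_real p))"
    using assms by (simp add: constant_degree)
  then show thesis
    using fundamental_theorem_of_algebra that unfolding complex_eval_def by blast
qed

text \<open>Necessity half of the Hautus test. Since v annihilates B, the input drops out of the
  functional y = v x, which then solves y' = z y. A solution starting at the origin keeps y = 0, yet
  controllability lets it reach every unit vector.\<close>

lemma controllable_left_eigenvector_zero:
  fixes A :: "real ^ 'nx ^ 'nx" and B :: "real ^ 'nu ^ 'nx" and v :: "'nx \<Rightarrow> complex"
  assumes "controllable A B"
    and vA: "\<And>l. (\<Sum>k\<in>UNIV. v k * of_real (A $ k $ l)) = z * v l"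
    and vB: "\<And>l. (\<Sum>k\<in>UNIV. v k * of_real (B $ k $ l)) = 0"
  shows "v m = 0"
proof -
  \<comment> \<open>The target \<open>axis m 1\<close> is chosen so that \<open>y T\<close> reads
    off the entry \<open>v m\<close>.\<close>
  obtain T x u where T: "T > 0" "ode_solution A B x u" "x 0 = 0" "x T = axis m 1"
    using assms(1) unfolding controllable_def by blast
  define y where "y t = (\<Sum>k\<in>UNIV. v k * of_real (x t $ k))" for t
  have y': "(y has_vector_derivative z * y t) (at t)" for t
  proof -
    have "((\<lambda>t. x t $ k) has_vector_derivative (A *v x t + B *v u t) $ k) (at t)" for k
      using T(2) unfolding ode_solution_def
      by (intro bounded_linear.has_vector_derivative[OF bounded_linear_vec_nth]) blast
    then have "(y has_vector_derivative
        (\<Sum>k\<in>UNIV. v k * of_real ((A *v x t + B *v u t) $ k))) (at t)"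
      unfolding y_def
      by (intro has_vector_derivative_sum has_vector_derivative_mult_right
          bounded_linear.has_vector_derivative[OF bounded_linear_of_real])
    moreover have "(\<Sum>k\<in>UNIV. v k * of_real ((A *v x t + B *v u t) $ k)) = z * y t"
    proof -
      have "(\<Sum>k\<in>UNIV. v k * of_real ((A *v x t) $ k))
          = (\<Sum>k\<in>UNIV. \<Sum>l\<in>UNIV. v k * of_real (A $ k $ l) * of_real (x t $ l))"
        by (simp add: matrix_vector_mult_def sum_distrib_left mult.assoc)
      also have "\<dots> = (\<Sum>l\<in>UNIV. (\<Sum>k\<in>UNIV. v k * of_real (A $ k $ l)) * of_real (x t $ l))"
        by (subst sum.swap) (simp add: sum_distrib_right)
      also have "\<dots> = z * y t"
        by (simp add: vA y_def sum_distrib_left mult.assoc)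
      finally have a: "(\<Sum>k\<in>UNIV. v k * of_real ((A *v x t) $ k)) = z * y t" .
      have "(\<Sum>k\<in>UNIV. v k * of_real ((B *v u t) $ k))
          = (\<Sum>k\<in>UNIV. \<Sum>l\<in>UNIV. v k * of_real (B $ k $ l) * of_real (u t $ l))"
        by (simp add: matrix_vector_mult_def sum_distrib_left mult.assoc)
      also have "\<dots> = (\<Sum>l\<in>UNIV. (\<Sum>k\<in>UNIV. v k * of_real (B $ k $ l)) * of_real (u t $ l))"
        by (subst sum.swap) (simp add: sum_distrib_right)
      also have "\<dots> = 0"
        by (simp add: vB)
      finally show ?thesis
        using a by (simp add: ring_distribs sum.distrib)
    qed
    ultimately show ?thesis by simp
  qed
  \<comment> \<open>The integrating factor exp(-tz) turns y' = z y into a conserved quantity, so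
    \<open>y 0 = 0\<close> forces \<open>y T = 0\<close>.\<close>
  have "((\<lambda>t. exp (t *\<^sub>R (- z)) * y t) has_vector_derivative 0) (at t)" for t
    by (rule has_vector_derivative_eq_rhs,
        rule has_vector_derivative_mult[OF exp_scaleR_has_vector_derivative_right y'])
       (simp add: algebra_simps)
  then obtain c where c: "\<And>t. exp (t *\<^sub>R (- z)) * y t = c"
    using has_vector_derivative_zero_constant[of UNIV "\<lambda>t. exp (t *\<^sub>R (- z)) * y t"] by auto
  have "y 0 = 0"
    by (simp add: y_def T)
  then have "y T = 0"
    using c[of 0] c[of T] by simp
  moreover have "y T = v m"
    by (simp add: y_def T axis_def if_distrib[of of_real] if_distrib[of "\<lambda>r. _ * r"] cong: if_cong)
  ultimately show ?thesis by simp
qed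

lemma smith_diagonal_zero_or_one:
  fixes A :: "real ^ 'nx ^ 'nx" and B :: "real ^ 'nu ^ 'nx"
  assumes ctrl: "controllable A B"
    and smith: "smith_factorization (system_matrix A B) Q V D"
  shows "D $ i $ Inl i = 0 \<or> D $ i $ Inl i = 1"
proof (rule ccontr)
  let ?p = "D $ i $ Inl i"
  assume *: "\<not> (?p = 0 \<or> ?p = 1)"
  have D0: "D $ i $ c = 0" if "c \<noteq> Inl i" for c
    using smith that unfolding smith_factorization_def smith_form_def by blast
  have lead: "lead_coeff ?p = 1"
    using smith * unfolding smith_factorization_def smith_form_def by blast
  \<comment> \<open>Monic normalization excludes constants other than 1, so the entry must have a
    complex root.\<close>
  have "degree ?p \<noteq> 0"
  proof
    assume "degree ?p = 0"
    then obtain a where "?p = [:a:]" by (rule degree_eq_zeroE)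
    with lead have "?p = 1" by (simp add: one_pCons)
    with * show False by simp
  qed
  then obtain z where z: "complex_eval z ?p = 0"
    by (rule complex_eval_root_exists)
  obtain V' where V': "V ** V' = mat 1"
    using smith unfolding smith_factorization_def invertible_def by blast
  obtain Q' where Q': "Q ** Q' = mat 1"
    using smith unfolding smith_factorization_def invertible_def by blast
  \<comment> \<open>Moving V to the other side makes row i of this product the multiple of row i of
    \<open>V'\<close> by \<open>?p\<close>; it therefore vanishes at the root z.\<close>
  have "Q ** system_matrix A B = Q ** system_matrix A B ** (V ** V')"
    by (simp add: V')
  also have "\<dots> = D ** V'"
    using smith unfolding smith_factorization_def by (simp add: matrix_mul_assoc)
  finally have QH: "Q ** system_matrix A B = D ** V'" .
  define v where "v k = complex_eval z (Q $ i $ k)" for k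
  have row: "(\<Sum>k\<in>UNIV. v k * complex_eval z (system_matrix A B $ k $ c)) = 0" for c
  proof -
    have "(\<Sum>k\<in>UNIV. Q $ i $ k * system_matrix A B $ k $ c) = (\<Sum>c'\<in>UNIV. D $ i $ c' * V' $ c' $ c)"
      using arg_cong[OF QH, of "\<lambda>M. M $ i $ c"] by (simp add: matrix_matrix_mult_def)
    also have "\<dots> = (\<Sum>c'\<in>{Inl i}. D $ i $ c' * V' $ c' $ c)"
      by (rule sum.mono_neutral_right) (auto simp: D0)
    finally show ?thesis
      using z by (simp add: v_def flip: complex_eval_mult complex_eval_sum)
        (simp add: complex_eval_mult)
  qed
  \<comment> \<open>At z the operator d/dt becomes the number z: the state columns give the left
    eigenvector equation for A, the input columns give v B = 0.\<close>
  have "(\<Sum>k\<in>UNIV. v k * of_real (A $ k $ l)) = z * v l" for l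
  proof -
    have "complex_eval z (system_matrix A B $ k $ Inl l)
        = of_real (A $ k $ l) - (if k = l then z else 0)" for k
      by (simp add: system_matrix_def)
    with row[of "Inl l"] show ?thesis
      by (simp add: right_diff_distrib sum_subtractf if_distrib[of "\<lambda>r. _ * r"] mult.commute
          cong: if_cong)
  qed
  moreover have "(\<Sum>k\<in>UNIV. v k * of_real (B $ k $ l)) = 0" for l
    using row[of "Inr l"] by (simp add: system_matrix_def)
  ultimately have v0: "v k = 0" for k
    by (rule controllable_left_eigenvector_zero[OF ctrl])
  \<comment> \<open>Invertibility of Q survives evaluation, so row i of Q cannot vanish at
    z.\<close>
  have "(\<Sum>k\<in>UNIV. Q $ i $ k * Q' $ k $ i) = 1"
    using arg_cong[OF Q', of "\<lambda>M. M $ i $ i"] by (simp add: matrix_matrix_mult_def mat_def)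
  then have "(\<Sum>k\<in>UNIV. v k * complex_eval z (Q' $ k $ i)) = 1"
    by (simp add: v_def flip: complex_eval_mult complex_eval_sum)
  then show False
    by (simp add: v0)
qed

section \<open>Columns of V annihilated by the system matrix\<close>

lemma sum_UNIV_sum:
  fixes f :: "'a::finite + 'b::finite \<Rightarrow> 'c::comm_monoid_add"
  shows "sum f UNIV = (\<Sum>i\<in>UNIV. f (Inl i)) + (\<Sum>j\<in>UNIV. f (Inr j))"
  by (simp add: sum.Plus comp_def flip: UNIV_Plus_UNIV)

text \<open>Cancelling Q in Q H V = D shows that H V inherits the zero columns of D. The d/dt term
  of row i is moved to the right, where \<open>pCons 0\<close> is multiplication by d/dt.\<close>

lemma smith_zero_column:
  fixes A :: "real ^ 'nx ^ 'nx" and B :: "real ^ 'nu ^ 'nx"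
  assumes smith: "smith_factorization (system_matrix A B) Q V D" and c: "diag_entry D c = 0"
  shows "(\<Sum>k\<in>UNIV. smult (A $ i $ k) (V $ Inl k $ c)) + (\<Sum>l\<in>UNIV. smult (B $ i $ l) (V $ Inr l $ c))
    = pCons 0 (V $ Inl i $ c)"
proof -
  have D0: "D $ k $ c = 0" for k
    using smith c unfolding smith_factorization_def smith_form_def diag_entry_def
    by (cases "c = Inl k") auto
  obtain Q' where Q': "Q' ** Q = mat 1"
    using smith unfolding smith_factorization_def invertible_def by blast
  have "system_matrix A B ** V = Q' ** D"
    using smith Q' unfolding smith_factorization_def by (metis matrix_mul_assoc matrix_mul_lid)
  from arg_cong[OF this, of "\<lambda>M. M $ i $ c"]
  have "(\<Sum>a\<in>UNIV. system_matrix A B $ i $ a * V $ a $ c) = 0"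
    by (simp add: matrix_matrix_mult_def D0)
  moreover have "(\<Sum>k\<in>UNIV. (if i = k then [:0, 1:] else 0) * V $ Inl k $ c) = pCons 0 (V $ Inl i $ c)"
    by (simp add: if_distrib[of "\<lambda>r. r * _"] cong: if_cong)
  ultimately show ?thesis
    by (simp add: sum_UNIV_sum system_matrix_def left_diff_distrib sum_subtractf algebra_simps)
qed

section \<open>Differential operators applied to kernels\<close>

lemma diff_op_conv_sum:
  assumes "degree p \<le> n"
  shows "diff_op p f t = (\<Sum>i\<le>n. coeff p i * (deriv ^^ i) f t)"
  unfolding diff_op_def using assms
  by (intro sum.mono_neutral_left) (auto simp: coeff_eq_0)

lemma diff_op_0 [simp]: "diff_op 0 f t = 0"
  by (simp add: diff_op_def)

lemma diff_op_add: "diff_op (p + q) f t = diff_op p f t + diff_op q f t"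
  by (simp add: diff_op_conv_sum[of _ "max (degree p) (degree q)"] degree_add_le sum.distrib
      ring_distribs)

lemma diff_op_smult: "diff_op (smult a p) f t = a * diff_op p f t"
  by (simp add: diff_op_conv_sum[of _ "degree p"] sum_distrib_left mult.assoc)

lemma diff_op_sum: "diff_op (sum p S) f t = (\<Sum>x\<in>S. diff_op (p x) f t)"
  by (induction S rule: infinite_finite_induct) (simp_all add: diff_op_add)

lemma diff_op_zero_fun: "diff_op p (\<lambda>_. 0) t = 0"
proof -
  have "(deriv ^^ i) (\<lambda>_. 0 :: real) = (\<lambda>_. 0)" for i
    by (induction i) auto
  then show ?thesis by (simp add: diff_op_def)
qed

lemma diff_op_pCons_0:
  "diff_op (pCons 0 p) f t = (\<Sum>i\<le>degree p. coeff p i * (deriv ^^ Suc i) f t)"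
  \<comment> \<open>\<open>pCons 0 p\<close> has degree one more than p only for nonzero p; the
    bound \<open>Suc (degree p)\<close> covers p = 0 too.\<close>
  by (subst diff_op_conv_sum[of _ "Suc (degree p)"])
     (simp_all add: degree_pCons_le sum.atMost_Suc_shift del: sum.atMost_Suc funpow.simps)

lemma has_real_derivative_diff_op:
  assumes "\<And>i. i \<le> degree p \<Longrightarrow> (deriv ^^ i) f differentiable (at t)"
  shows "(diff_op p f has_real_derivative diff_op (pCons 0 p) f t) (at t)"
proof -
  have "((deriv ^^ i) f has_real_derivative (deriv ^^ Suc i) f t) (at t)" if "i \<le> degree p" for i
    using assms[OF that] by (simp add: DERIV_deriv_iff_real_differentiable)
  then show ?thesis
    unfolding diff_op_pCons_0 unfolding diff_op_def[abs_def]
    by (intro DERIV_sum DERIV_cmult) auto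
qed

lemma continuous_on_diff_op:
  assumes "\<And>i. i \<le> degree p \<Longrightarrow> continuous_on S ((deriv ^^ i) f)"
  shows "continuous_on S (diff_op p f)"
  unfolding diff_op_def[abs_def] using assms by (intro continuous_intros) auto

text \<open>\<open>kernel_partial\<close> differentiates in the second argument first, just as p is
  applied here, so each further derivative in s acts on the finite sum term by term.\<close>

lemma deriv_funpow_diff_op_kernel:
  assumes k: "smooth_kernel d k" and deg: "degree p \<le> d" and n: "n \<le> d"
  shows "(deriv ^^ n) (\<lambda>s. diff_op p (k s) t) s
    = (\<Sum>q\<le>degree p. coeff p q * kernel_partial k n q s t)"
  using n
proof (induction n arbitrary: s)
  case 0
  show ?case by (simp add: diff_op_def kernel_partial_def)
next
  case (Suc n)
  have "((\<lambda>s'. kernel_partial k n q s' t) has_real_derivative kernel_partial k (Suc n) q s t) (at s)"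
    if "q \<le> degree p" for q
  proof -
    have "(\<lambda>s'. kernel_partial k n q s' t) differentiable (at s)"
      using k Suc.prems that deg unfolding smooth_kernel_def by simp
    then show ?thesis
      by (simp add: kernel_partial_def flip: DERIV_deriv_iff_real_differentiable)
  qed
  then have "((\<lambda>s. \<Sum>q\<le>degree p. coeff p q * kernel_partial k n q s t) has_real_derivative
      (\<Sum>q\<le>degree p. coeff p q * kernel_partial k (Suc n) q s t)) (at s)"
    by (intro DERIV_sum DERIV_cmult) auto
  moreover have "(deriv ^^ n) (\<lambda>s. diff_op p (k s) t)
      = (\<lambda>s. \<Sum>q\<le>degree p. coeff p q * kernel_partial k n q s t)"
    using Suc by (intro ext) simp
  ultimately show ?case
    by (simp add: DERIV_imp_deriv)
qed

lemma differentiable_diff_op_kernel: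
  assumes k: "smooth_kernel d k" and deg: "degree p \<le> d" and n: "n < d"
  shows "(deriv ^^ n) (\<lambda>s. diff_op p (k s) t) differentiable (at s)"
proof -
  have "(deriv ^^ n) (\<lambda>s. diff_op p (k s) t)
      = (\<lambda>s. \<Sum>q\<le>degree p. coeff p q * kernel_partial k n q s t)"
    using deriv_funpow_diff_op_kernel[OF k deg] n by (intro ext) simp
  moreover have "(\<lambda>s. kernel_partial k n q s t) differentiable (at s)" if "q \<le> degree p" for q
    using k n that deg unfolding smooth_kernel_def by simp
  ultimately show ?thesis
    by (auto intro!: differentiable_sum differentiable_mult)
qed

lemma continuous_on_diff_op_kernel:
  assumes k: "smooth_kernel d k" and deg: "degree p \<le> d" and n: "n \<le> d"
  shows "continuous_on UNIV ((deriv ^^ n) (\<lambda>s. diff_op p (k s) t))"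
proof -
  have "(deriv ^^ n) (\<lambda>s. diff_op p (k s) t)
      = (\<lambda>s. \<Sum>q\<le>degree p. coeff p q * kernel_partial k n q s t)"
    using deriv_funpow_diff_op_kernel[OF k deg n] by (intro ext) simp
  moreover have "continuous_on UNIV (\<lambda>s. kernel_partial k n q s t)" if "q \<le> degree p" for q
  proof -
    have "continuous_on UNIV (\<lambda>(s, t). kernel_partial k n q s t)"
      using k n that deg unfolding smooth_kernel_def by simp
    from continuous_on_compose2[OF this, of UNIV "\<lambda>s. (s, t)"] show ?thesis
      by (simp add: continuous_intros)
  qed
  ultimately show ?thesis
    by (auto intro!: continuous_intros)
qed

section \<open>Trajectories\<close>

text \<open>State and input form one vector-valued function, so that solutions can be superposed and
  restricted to the grid by plain vector operations.\<close>

definition trajectory ::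
  "real ^ 'nx ^ 'nx \<Rightarrow> real ^ 'nu ^ 'nx \<Rightarrow> (real \<Rightarrow> real ^ ('nx :: finite + 'nu :: finite)) \<Rightarrow> bool"
where
  "trajectory A B w \<longleftrightarrow> ode_solution A B (\<lambda>t. \<chi> i. w t $ Inl i) (\<lambda>t. \<chi> l. w t $ Inr l)"

lemma stack_nth [simp]: "stack x u $ Inl i = x $ i" "stack x u $ Inr l = u $ l"
  by (simp_all add: stack_def)

lemma stack_components: "stack (\<chi> i. w $ Inl i) (\<chi> l. w $ Inr l) = w"
proof -
  have "stack (\<chi> i. w $ Inl i) (\<chi> l. w $ Inr l) $ c = w $ c" for c
    by (cases c) simp_all
  then show ?thesis
    by (simp add: vec_eq_iff)
qed

lemma trajectory_0: "trajectory A B (\<lambda>t. 0)"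
  by (simp add: trajectory_def ode_solution_def flip: zero_vec_def)

lemma trajectory_add:
  assumes "trajectory A B w" "trajectory A B w'"
  shows "trajectory A B (\<lambda>t. w t + w' t)"
proof -
  have *: "(\<chi> i. w t $ Inl i + w' t $ Inl i) = (\<chi> i. w t $ Inl i) + (\<chi> i. w' t $ Inl i)"
    "(\<chi> l. w t $ Inr l + w' t $ Inr l) = (\<chi> l. w t $ Inr l) + (\<chi> l. w' t $ Inr l)" for t
    by (simp_all add: vec_eq_iff)
  show ?thesis
    using assms unfolding trajectory_def ode_solution_def vector_add_component *
    by (auto intro!: continuous_on_add has_vector_derivative_eq_rhs[OF has_vector_derivative_add]
        simp: matrix_vector_right_distrib)
qed

lemma trajectory_scaleR:
  assumes "trajectory A B w"
  shows "trajectory A B (\<lambda>t. r *\<^sub>R w t)"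
proof -
  have *: "(\<chi> i. r * w t $ Inl i) = r *\<^sub>R (\<chi> i. w t $ Inl i)"
    "(\<chi> l. r * w t $ Inr l) = r *\<^sub>R (\<chi> l. w t $ Inr l)" for t
    by (simp_all add: vec_eq_iff)
  show ?thesis
    using assms unfolding trajectory_def ode_solution_def vector_scaleR_component real_scaleR_def *
    by (auto intro!: continuous_on_scaleR
          has_vector_derivative_eq_rhs[OF bounded_linear.has_vector_derivative[OF bounded_linear_scaleR_right]]
        simp: matrix_vector_mult_scaleR scaleR_right_distrib)
qed

lemma trajectory_sum:
  assumes "\<And>x. x \<in> S \<Longrightarrow> trajectory A B (w x)"
  shows "trajectory A B (\<lambda>t. \<Sum>x\<in>S. w x t)"
  using assms
  by (induction S rule: infinite_finite_induct) (simp_all add: trajectory_0 trajectory_add)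

lemma has_vector_derivative_vec_lambda:
  assumes "\<And>i. ((\<lambda>t. f t i) has_real_derivative f' $ i) (at t)"
  shows "((\<lambda>t. \<chi> i. f t i) has_vector_derivative f') (at t)"
  using assms unfolding has_vector_derivative_def has_field_derivative_def
  by (subst has_derivative_componentwise_within)
     (auto simp: Basis_vec_def inner_axis mult_commute_abs)

text \<open>The degree bound suffices although \<open>x\<close> is differentiated once more: the system equation
  forces the state entries of the column to have degree strictly below \<open>d\<close>.\<close>

lemma trajectory_diff_op:
  fixes A :: "real ^ 'nx ^ 'nx" and B :: "real ^ 'nu ^ 'nx"
  assumes col: "\<And>i. (\<Sum>k\<in>UNIV. smult (A $ i $ k) (v (Inl k)))
      + (\<Sum>l\<in>UNIV. smult (B $ i $ l) (v (Inr l))) = pCons 0 (v (Inl i))"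
    and deg: "\<And>a. degree (v a) \<le> d"
    and diff: "\<And>n t. n < d \<Longrightarrow> (deriv ^^ n) g differentiable (at t)"
    and cont: "\<And>n. n \<le> d \<Longrightarrow> continuous_on UNIV ((deriv ^^ n) g)"
  shows "trajectory A B (\<lambda>t. \<chi> a. diff_op (v a) g t)"
proof -
  let ?x = "\<lambda>t. \<chi> i. diff_op (v (Inl i)) g t" and ?u = "\<lambda>t. \<chi> l. diff_op (v (Inr l)) g t"
  have "continuous_on UNIV (diff_op (v a) g)" for a
    using deg[of a] by (intro continuous_on_diff_op cont) simp
  then have "continuous_on UNIV ?u"
    by (intro continuous_on_vec_lambda)
  moreover have "(?x has_vector_derivative A *v ?x t + B *v ?u t) (at t)" for t
  proof (rule has_vector_derivative_vec_lambda)
    fix i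
    have "(A *v ?x t + B *v ?u t) $ i = diff_op (pCons 0 (v (Inl i))) g t"
      unfolding col[symmetric]
      by (simp add: matrix_vector_mult_def diff_op_add diff_op_sum diff_op_smult)
    moreover have "(diff_op (v (Inl i)) g has_real_derivative diff_op (pCons 0 (v (Inl i))) g t) (at t)"
    \<comment> \<open>The zero entry is separate because \<open>pCons 0 0\<close> is again 0, so its
      degree bound would not give \<open>degree (v (Inl i)) < d\<close>, for instance when d is
      0.\<close>
    proof (cases "v (Inl i) = 0")
      case True
      then show ?thesis by (simp add: diff_op_def[abs_def])
    next
      case False
      have "degree (pCons 0 (v (Inl i))) \<le> d"
        unfolding col[symmetric]
        by (intro degree_add_le degree_sum_le order_trans[OF degree_smult_le deg]) auto
      with False show ?thesis
        by (intro has_real_derivative_diff_op diff) simp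
    qed
    ultimately show "(diff_op (v (Inl i)) g has_real_derivative (A *v ?x t + B *v ?u t) $ i) (at t)"
      by simp
  qed
  ultimately show ?thesis
    by (simp add: trajectory_def ode_solution_def)
qed

text \<open>The latent kernel is diagonal, so a column of the pushed-forward kernel is a sum over c
  of column c of V applied to one scalar function. Superposition reduces the claim to a single
  c.\<close>

lemma trajectory_lode_kernel:
  fixes A :: "real ^ 'nx ^ 'nx" and B :: "real ^ 'nu ^ 'nx"
    and \<kappa> :: "'nx::finite + 'nu::finite \<Rightarrow> real \<Rightarrow> real \<Rightarrow> real"
  assumes ctrl: "controllable A B"
    and smith: "smith_factorization (system_matrix A B) Q V D"
    and smooth: "\<And>c. diag_entry D c = 0 \<Longrightarrow> smooth_kernel (column_order V c) (\<kappa> c)"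
  shows "trajectory A B (\<lambda>s. \<chi> a. lode_kernel V D \<kappa> s a t b)"
proof -
  define g where "g c s = diff_op (V $ b $ c) (latent_kernel D \<kappa> c s) t" for c s
  have "trajectory A B (\<lambda>s. \<chi> a. diff_op (V $ a $ c) (g c) s)" for c
  proof (cases "diag_entry D c = 0")
    case True
    then have "g c = (\<lambda>s. diff_op (V $ b $ c) (\<kappa> c s) t)"
      by (simp add: g_def[abs_def] latent_kernel_def)
    moreover have "degree (V $ a $ c) \<le> column_order V c" for a
      unfolding column_order_def by (intro Max_ge) auto
    ultimately show ?thesis
      using smith_zero_column[OF smith True] smooth[OF True]
      by (intro trajectory_diff_op[where d = "column_order V c"])
         (simp_all add: differentiable_diff_op_kernel continuous_on_diff_op_kernel)
  next
    case False
    \<comment> \<open>Controllability enters here: a nonzero diagonal entry must be 1, the value at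
      which \<open>latent_kernel\<close> switches to the zero kernel.\<close>
    then have "diag_entry D c = 1"
      using smith_diagonal_zero_or_one[OF ctrl smith] by (auto simp: diag_entry_def split: sum.splits)
    then have "g c = (\<lambda>s. 0)"
      by (simp add: g_def[abs_def] latent_kernel_def diff_op_zero_fun)
    moreover have "(\<chi> a. 0) = (0 :: real ^ ('nx + 'nu))"
      by (simp add: vec_eq_iff)
    ultimately show ?thesis
      by (simp add: diff_op_zero_fun trajectory_0)
  qed
  then have "trajectory A B (\<lambda>s. \<Sum>c\<in>UNIV. \<chi> a. diff_op (V $ a $ c) (g c) s)"
    by (intro trajectory_sum)
  moreover have "(\<Sum>c\<in>UNIV. \<chi> a. diff_op (V $ a $ c) (g c) s)
      = (\<chi> a. lode_kernel V D \<kappa> s a t b)" for s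
    by (simp add: vec_eq_iff lode_kernel_def pushforward_kernel_def g_def[abs_def])
  ultimately show ?thesis by simp
qed

section \<open>Grid values of trajectories as a linear subspace\<close>

definition grid_trajectories ::
  "real ^ 'nx ^ 'nx \<Rightarrow> real ^ 'nu ^ 'nx \<Rightarrow> ('g \<Rightarrow> real) \<Rightarrow>
   (real ^ ('nx :: finite + 'nu :: finite) ^ 'g) set"
where
  "grid_trajectories A B \<tau> = {z. \<exists>w. trajectory A B w \<and> z = (\<chi> j. w (\<tau> j))}"

lemma subspace_grid_trajectories: "subspace (grid_trajectories A B \<tau>)"
proof -
  let ?restrict = "\<lambda>w. \<chi> j. w (\<tau> j)" and ?L = "grid_trajectories A B \<tau>"
  have in_L: "?restrict w \<in> ?L" if "trajectory A B w" for w
    using that unfolding grid_trajectories_def by blast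
  have "0 \<in> ?L"
    using in_L[OF trajectory_0] by (simp flip: zero_vec_def)
  moreover have "y + z \<in> ?L" if yz: "y \<in> ?L" "z \<in> ?L" for y z
  proof -
    obtain w w' where w: "trajectory A B w" "trajectory A B w'" "y = ?restrict w" "z = ?restrict w'"
      using yz unfolding grid_trajectories_def by blast
    then have "y + z = ?restrict (\<lambda>t. w t + w' t)"
      by (simp add: vec_eq_iff)
    with in_L[OF trajectory_add[OF w(1,2)]] show ?thesis by simp
  qed
  moreover have "r *\<^sub>R y \<in> ?L" if y: "y \<in> ?L" for r y
  proof -
    obtain w where w: "trajectory A B w" "y = ?restrict w"
      using y unfolding grid_trajectories_def by blast
    then have "r *\<^sub>R y = ?restrict (\<lambda>t. r *\<^sub>R w t)"
      by (simp add: vec_eq_iff)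
    with in_L[OF trajectory_scaleR[OF w(1), of r]] show ?thesis by simp
  qed
  ultimately show ?thesis
    by (auto simp: subspace_def)
qed

section \<open>Concentration of degenerate Gaussian laws\<close>

text \<open>Each functional w brings its own exceptional null set. A finite basis of the orthogonal
  complement leaves only finitely many of them, and a vector orthogonal to that basis lies in the
  double complement, which is L.\<close>

lemma AE_in_subspace:
  fixes L :: "'a::euclidean_space set"
  assumes "subspace L" and AE: "\<And>w. w \<in> L\<^sup>\<bottom> \<Longrightarrow> AE z in M. w \<bullet> z = 0"
  shows "AE z in M. z \<in> L"
proof -
  obtain W where W: "W \<subseteq> L\<^sup>\<bottom>" "independent W" "L\<^sup>\<bottom> \<subseteq> span W"
    by (rule basis_exists)
  have "finite W"
    using W(2) by (rule independent_imp_finite)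
  with W(1) AE have "AE z in M. \<forall>w\<in>W. w \<bullet> z = 0"
    by (intro AE_finite_allI) auto
  then show ?thesis
  proof eventually_elim
    case (elim z)
    have "subspace {w. w \<bullet> z = 0}"
      by (simp add: subspace_def inner_add_left)
    with elim have "span W \<subseteq> {w. w \<bullet> z = 0}"
      by (intro span_minimal) auto
    with W(3) have "z \<in> L\<^sup>\<bottom>\<^sup>\<bottom>"
      by (auto simp: orthogonal_comp_def orthogonal_def)
    then show "z \<in> L"
      using orthogonal_comp_self[OF assms(1)] by simp
  qed
qed

lemma gaussian_law_AE_in_subspace:
  fixes \<gamma> :: "(real ^ 'c ^ 'g) measure"
  assumes gauss: "gaussian_law \<gamma> m S" and L: "subspace L"
    and mean: "(\<chi> j a. m j a) \<in> L"
    and cov: "\<And>k b. (\<chi> j a. S j a k b) \<in> L"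
  shows "AE z in \<gamma>. z \<in> L"
proof (rule AE_in_subspace[OF L])
  fix w assume "w \<in> L\<^sup>\<bottom>"
  then have w: "w \<bullet> y = 0" if "y \<in> L" for y
    using that by (auto simp: orthogonal_comp_def orthogonal_def inner_commute)
  have "(\<Sum>j\<in>UNIV. \<Sum>a\<in>UNIV. w $ j $ a * m j a) = 0"
    using w[OF mean] by (simp add: inner_vec_def)
  \<comment> \<open>The sums are reordered until (j, a) is innermost; for fixed (k, b) they form the
    inner product of w with a covariance column, which lies in L.\<close>
  moreover have "(\<Sum>j\<in>UNIV. \<Sum>a\<in>UNIV. \<Sum>k\<in>UNIV. \<Sum>b\<in>UNIV. w $ j $ a * w $ k $ b * S j a k b) = 0"
  proof -
    have "(\<Sum>j\<in>UNIV. \<Sum>a\<in>UNIV. \<Sum>k\<in>UNIV. \<Sum>b\<in>UNIV. w $ j $ a * w $ k $ b * S j a k b)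
        = (\<Sum>j\<in>UNIV. \<Sum>k\<in>UNIV. \<Sum>a\<in>UNIV. \<Sum>b\<in>UNIV. w $ j $ a * w $ k $ b * S j a k b)"
      by (rule sum.cong[OF refl], rule sum.swap)
    also have "\<dots> = (\<Sum>k\<in>UNIV. \<Sum>j\<in>UNIV. \<Sum>a\<in>UNIV. \<Sum>b\<in>UNIV. w $ j $ a * w $ k $ b * S j a k b)"
      by (rule sum.swap)
    also have "\<dots> = (\<Sum>k\<in>UNIV. \<Sum>j\<in>UNIV. \<Sum>b\<in>UNIV. \<Sum>a\<in>UNIV. w $ j $ a * w $ k $ b * S j a k b)"
      by (rule sum.cong[OF refl], rule sum.cong[OF refl], rule sum.swap)
    also have "\<dots> = (\<Sum>k\<in>UNIV. \<Sum>b\<in>UNIV. \<Sum>j\<in>UNIV. \<Sum>a\<in>UNIV. w $ j $ a * w $ k $ b * S j a k b)"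
      by (rule sum.cong[OF refl], rule sum.swap)
    also have "\<dots> = (\<Sum>k\<in>UNIV. \<Sum>b\<in>UNIV. w $ k $ b * (w \<bullet> (\<chi> j a. S j a k b)))"
      by (simp add: inner_vec_def sum_distrib_left ac_simps)
    also have "\<dots> = 0"
      by (simp add: w cov)
    finally show ?thesis .
  qed
  \<comment> \<open>Variance 0 selects the degenerate branch of \<open>normal_law\<close>, a point
    mass at the mean 0.\<close>
  ultimately have distr: "distr \<gamma> borel (\<lambda>z. w \<bullet> z) = return borel 0"
    using gauss unfolding gaussian_law_def Let_def by (auto simp: normal_law_def dest: spec[of _ w])
  have sets: "sets \<gamma> = sets borel"
    using gauss by (simp add: gaussian_law_def)
  have meas: "(\<lambda>z. w \<bullet> z) \<in> measurable \<gamma> borel"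
    unfolding measurable_cong_sets[OF sets refl] by (intro borel_measurable_continuous_onI continuous_intros)
  have "AE y in distr \<gamma> borel (\<lambda>z. w \<bullet> z). y = 0"
    unfolding distr by (subst AE_return) auto
  then show "AE z in \<gamma>. w \<bullet> z = 0"
    by (subst (asm) AE_distr_iff[OF meas]) auto
qed

text \<open>Conditioning only takes linear combinations of prior kernel columns: in every term just
  one factor depends on (j, a), and it is a kernel column. Observed values, entries of the inverse
  Gram matrix and the remaining kernel values are scalars, so membership in the subspace passes from
  prior to posterior.\<close>

lemma conditioned_gp_AE_grid_trajectories:
  fixes \<gamma> :: "(real ^ ('nx::finite + 'nu::finite) ^ 'g::finite) measure"
  assumes traj: "\<And>t b. trajectory A B (\<lambda>s. \<chi> a. K s a t b)"
    and law: "conditioned_gp_law \<gamma> K obs \<tau>"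
  shows "AE z in \<gamma>. z \<in> grid_trajectories A B \<tau>"
proof -
  let ?L = "grid_trajectories A B \<tau>" and ?n = "length obs"
    and ?W = "inverse_entries (length obs) (noisy_gram K obs)"
  let ?t = "\<lambda>i. obs_time (obs ! i)" and ?c = "\<lambda>i. obs_channel (obs ! i)"
  define Y where "Y t b = (\<chi> j a. K (\<tau> j) a t b)" for t b
  have Y: "Y t b \<in> ?L" for t b
    unfolding Y_def grid_trajectories_def using traj[of t b] by blast
  note closure = subspace_sum[OF subspace_grid_trajectories]
    subspace_scale[OF subspace_grid_trajectories] subspace_diff[OF subspace_grid_trajectories]
  have "(\<chi> j a. posterior_mean K obs (\<tau> j) a)
      = (\<Sum>i<?n. \<Sum>l<?n. (?W i l * obs_value (obs ! l)) *\<^sub>R Y (?t i) (?c i))"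
    by (simp add: vec_eq_iff posterior_mean_def Let_def Y_def ac_simps)
  moreover have "(\<chi> j a. posterior_cov K obs (\<tau> j) a (\<tau> k) b)
      = Y (\<tau> k) b - (\<Sum>i<?n. \<Sum>l<?n. (?W i l * K (?t l) (?c l) (\<tau> k) b) *\<^sub>R Y (?t i) (?c i))" for k b
    by (simp add: vec_eq_iff posterior_cov_def Let_def Y_def ac_simps)
  ultimately show ?thesis
    using law unfolding conditioned_gp_law_def
    by (elim gaussian_law_AE_in_subspace[OF _ subspace_grid_trajectories]) (auto intro!: closure Y)
qed

text \<open>The part of C outside L is null for M, so the complement of \<open>L \<inter> C\<close>
  is null after restriction to C. As this intersection is closed, it is one of the sets whose
  intersection defines the support.\<close>

lemma measure_support_uniform_measure_subset:
  assumes sets: "sets M = sets borel" and C: "closed C"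
    and L: "closed L" "AE z in M. z \<in> L"
  shows "measure_support (uniform_measure M C) \<subseteq> L \<inter> C"
proof -
  have sp: "space M = UNIV"
    using sets_eq_imp_space_eq[OF sets] by simp
  have CM: "C \<in> sets M" and LM: "UNIV - L \<inter> C \<in> sets M"
    using C L(1) by (auto simp: sets)
  have "AE z in M. z \<in> C \<longrightarrow> z \<in> L"
    using L(2) by eventually_elim simp
  then have "emeasure M (C \<inter> (UNIV - L \<inter> C)) = 0"
    using CM LM by (subst (asm) AE_iff_measurable[where N = "C \<inter> (UNIV - L \<inter> C)"]) (auto simp: sp)
  then have "emeasure (uniform_measure M C) (UNIV - L \<inter> C) = 0"
    by (simp add: emeasure_uniform_measure[OF CM LM])
  then show ?thesis
    unfolding measure_support_def using C L(1) by (auto simp: sp)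
qed

lemma closed_grid_box: "closed (grid_box zmin zmax)"
  unfolding grid_box_def
  by (intro closed_Collect_all closed_Collect_conj closed_Collect_le continuous_intros)

theorem theorem3:
  fixes A :: "real ^ 'nx ^ 'nx" and B :: "real ^ 'nu ^ 'nx"
    and Q :: "real poly ^ 'nx ^ 'nx"
    and V :: "real poly ^ ('nx :: finite + 'nu :: finite) ^ ('nx + 'nu)"
    and D :: "real poly ^ ('nx + 'nu) ^ 'nx"
    and \<kappa> :: "'nx + 'nu \<Rightarrow> real \<Rightarrow> real \<Rightarrow> real"
    and obs :: "('nx + 'nu) observation list"
    and \<tau> :: "'g :: finite \<Rightarrow> real"
    and \<gamma> :: "(real ^ ('nx + 'nu) ^ 'g) measure"
    and zmin zmax :: "real ^ ('nx + 'nu)"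
  assumes "controllable A B"
    and "smith_factorization (system_matrix A B) Q V D"
    and "\<And>c. diag_entry D c = 0 \<Longrightarrow> covariance_function (\<kappa> c)"
    and "\<And>c. diag_entry D c = 0 \<Longrightarrow> smooth_kernel (column_order V c) (\<kappa> c)"
    and "\<And>ob. ob \<in> set obs \<Longrightarrow> obs_var ob > 0"
    and "conditioned_gp_law \<gamma> (lode_kernel V D \<kappa>) obs \<tau>"
    and "\<And>a. zmin $ a < zmax $ a"
    and "emeasure \<gamma> (grid_box zmin zmax) > 0"
  shows "\<forall>z \<in> measure_support (truncated_law \<gamma> zmin zmax).
      (\<exists>x u. ode_solution A B x u \<and> (\<forall>j. stack (x (\<tau> j)) (u (\<tau> j)) = z $ j)) \<and>
      (\<forall>j a. zmin $ a \<le> z $ j $ a \<and> z $ j $ a \<le> zmax $ a)"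
proof
  have "sets \<gamma> = sets borel"
    using assms(6) by (simp add: conditioned_gp_law_def gaussian_law_def)
  moreover have "AE z in \<gamma>. z \<in> grid_trajectories A B \<tau>"
    using trajectory_lode_kernel[OF assms(1,2,4)] assms(6)
    by (rule conditioned_gp_AE_grid_trajectories)
  \<comment> \<open>Closedness of the grid subspace carries the almost sure statement over to every
    point of the support.\<close>
  ultimately have supp: "measure_support (truncated_law \<gamma> zmin zmax)
      \<subseteq> grid_trajectories A B \<tau> \<inter> grid_box zmin zmax"
    unfolding truncated_law_def
    by (intro measure_support_uniform_measure_subset closed_grid_box
        closed_subspace[OF subspace_grid_trajectories])
  fix z assume "z \<in> measure_support (truncated_law \<gamma> zmin zmax)"
  then have z: "z \<in> grid_trajectories A B \<tau>" "z \<in> grid_box zmin zmax"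
    using supp by (simp_all add: subset_iff)
  from z(1) obtain w where w: "trajectory A B w" "z = (\<chi> j. w (\<tau> j))"
    unfolding grid_trajectories_def by blast
  \<comment> \<open>The witnesses are the state and input parts of w; stacking them gives back
    w.\<close>
  then have "ode_solution A B (\<lambda>t. \<chi> i. w t $ Inl i) (\<lambda>t. \<chi> l. w t $ Inr l)"
    and "\<forall>j. stack (\<chi> i. w (\<tau> j) $ Inl i) (\<chi> l. w (\<tau> j) $ Inr l) = z $ j"
    by (simp_all add: trajectory_def stack_components)
  then have "\<exists>x u. ode_solution A B x u \<and> (\<forall>j. stack (x (\<tau> j)) (u (\<tau> j)) = z $ j)"
    by (intro exI conjI)
  moreover have "\<forall>j a. zmin $ a \<le> z $ j $ a \<and> z $ j $ a \<le> zmax $ a"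
    using z(2) by (simp add: grid_box_def)
  ultimately show "(\<exists>x u. ode_solution A B x u \<and> (\<forall>j. stack (x (\<tau> j)) (u (\<tau> j)) = z $ j)) \<and>
      (\<forall>j a. zmin $ a \<le> z $ j $ a \<and> z $ j $ a \<le> zmax $ a)" ..
qed

end
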